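(* Let $m$ be a positive integer with $m>\lceil d_\epsilon\rceil+\lceil\tilde d_{\tilde\epsilon}\rceil$. Then the following (positive) quadrature rule holds: $$\frac1{2\pi}\int_0^\pi R(\xi)\rho(\xi)\,d\xi=\sum_{0\leq\hat l\leq m}R\bigl(\xi^{(m)}_{\hat l}\bigr)\,\rho\bigl(\xi^{(m)}_{\hat l}\bigr)\,\hat\Delta^{(m)}_{\hat l},$$ where $\rho$ is the Chebyshev weight function $$\rho(\xi):=2^{\epsilon_++\epsilon_-}(1+\epsilon_+\cos(\xi))(1-\epsilon_-\cos(\xi)),$$ and $R$ is any function of the form $$R(\xi)=\frac{f(\cos(\xi))}{\prod_{1\leq r\leq d}\bigl(1+2\alpha_r\cos(\xi)+\alpha_r^2\bigr)},$$ with $f(\cos(\xi))$ an arbitrary polynomial in $\cos(\xi)$ of degree at most $D:=2(m-\tilde d_{\tilde\epsilon})-1$.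
   Context: **Parameters.** Fix nonnegative integers $d,\tilde d$, signs $\epsilon_\pm,\tilde\epsilon_\pm\in\{0,1\}$, and parameters $\alpha_1,\ldots,\alpha_d$ and $\tilde\alpha_1,\ldots,\tilde\alpha_{\tilde d}$ with $0<|\alpha_r|<1$, $0<|\tilde\alpha_r|<1$, where possible complex parameters among the $\alpha_r$ occur in complex conjugate pairs, and likewise for the $\tilde\alpha_r$. Put $d_\epsilon:=\frac12(d-\epsilon_+-\epsilon_-)$ and $\tilde d_{\tilde\epsilon}:=\frac12(\tilde d-\tilde\epsilon_+-\tilde\epsilon_-)$. **Nodes.** For $|\alpha|<1$ let $u_\alpha(x):=\frac{1-\alpha^2}{1+2\alpha\cos(x)+\alpha^2}$. For a positive integer $m>\lceil d_\epsilon\rceil+\lceil\tilde d_{\tilde\epsilon}\rceil$ and $\hat l\in\{0,\ldots,m\}$, $\xi^{(m)}_{\hat l}$ denotes the unique real solution $\xi$ of $$2(m-d_\epsilon-\tilde d_{\tilde\epsilon})\xi+\sum_{1\leq r\leq d}\int_0^\xi u_{\alpha_r}(x)dx+\sum_{1\leq r\leq\tilde d}\int_0^\xi u_{\tilde\alpha_r}(x)dx=\pi(2\hat l+\epsilon_-+\tilde\epsilon_-).$$ One has $0\leq\xi^{(m)}_0<\xi^{(m)}_1<\cdots<\xi^{(m)}_m\leq\pi$. **Christoffel weights.** For $\hat l\in\{0,\ldots,m\}$, $$\hat\Delta^{(m)}_{\hat l}:=\left(\tfrac12\right)^{(1-\epsilon_-)(1-\tilde\epsilon_-)\delta_{\hat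 l}+(1-\epsilon_+)(1-\tilde\epsilon_+)\delta_{m-\hat l}}\Bigl(2(m-d_\epsilon-\tilde d_{\tilde\epsilon})+\sum_{1\leq r\leq d}u_{\alpha_r}(\xi^{(m)}_{\hat l})+\sum_{1\leq r\leq\tilde d}u_{\tilde\alpha_r}(\xi^{(m)}_{\hat l})\Bigr)^{-1},$$ where $\delta_x:=1$ if $x=0$ and $\delta_x:=0$ otherwise; these weights are positive. *)

theory Defs
  imports "HOL-Analysis.Analysis"
begin

text \<open>
  The shift \<open>(d - \<epsilon>\<^sub>+ - \<epsilon>\<^sub>-) / 2\<close>; it may be a half-integer, and negative.
\<close>

definition shift :: "nat \<Rightarrow> nat \<Rightarrow> nat \<Rightarrow> real" where
  "shift d ep em = (real d - real ep - real em) / 2"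

text \<open>
  Parameter families are functions of which only the values at \<open>1, \<dots>, d\<close> matter.
  Repetitions are allowed, so ``nonreal parameters come in conjugate pairs'' means that
  every value occurs as often as its conjugate (no condition on real values).
\<close>

definition conj_paired :: "nat \<Rightarrow> (nat \<Rightarrow> complex) \<Rightarrow> bool" where
  "conj_paired d \<alpha> \<longleftrightarrow>
     (\<forall>z. card {r \<in> {1..d}. \<alpha> r = z} = card {r \<in> {1..d}. \<alpha> r = cnj z})"

definition admissible :: "nat \<Rightarrow> (nat \<Rightarrow> complex) \<Rightarrow> bool" where
  "admissible d \<alpha> \<longleftrightarrow>
     (\<forall>r\<in>{1..d}. 0 < cmod (\<alpha> r) \<and> cmod (\<alpha> r) < 1) \<and> conj_paired d \<alpha>"

definition u :: "complex \<Rightarrow> real \<Rightarrow> complex" where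
  "u \<alpha> x = (1 - \<alpha>\<^sup>2) / (1 + 2 * \<alpha> * of_real (cos x) + \<alpha>\<^sup>2)"

text \<open>
  The left-hand side of the node equation. It is real for admissible parameters although the
  individual summands need not be. The interval integral is oriented, so \<open>\<xi>\<close> may be negative.
\<close>

definition node_fun ::
  "nat \<Rightarrow> nat \<Rightarrow> nat \<Rightarrow> (nat \<Rightarrow> complex) \<Rightarrow>
   nat \<Rightarrow> nat \<Rightarrow> nat \<Rightarrow> (nat \<Rightarrow> complex) \<Rightarrow> nat \<Rightarrow> real \<Rightarrow> complex" where
  "node_fun d ep em \<alpha> d' ep' em' \<alpha>' m \<xi> =
     of_real (2 * (real m - shift d ep em - shift d' ep' em') * \<xi>)
     + (\<Sum>r\<in>{1..d}. LBINT x=0..\<xi>. u (\<alpha> r) x)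
     + (\<Sum>r\<in>{1..d'}. LBINT x=0..\<xi>. u (\<alpha>' r) x)"

definition node ::
  "nat \<Rightarrow> nat \<Rightarrow> nat \<Rightarrow> (nat \<Rightarrow> complex) \<Rightarrow>
   nat \<Rightarrow> nat \<Rightarrow> nat \<Rightarrow> (nat \<Rightarrow> complex) \<Rightarrow> nat \<Rightarrow> nat \<Rightarrow> real" where
  "node d ep em \<alpha> d' ep' em' \<alpha>' m l =
     (THE \<xi>. node_fun d ep em \<alpha> d' ep' em' \<alpha>' m \<xi>
               = of_real (pi * (2 * real l + real em + real em')))"

text \<open>
  The Christoffel weights, for \<open>l \<le> m\<close>. The signs are \<open>0\<close> or \<open>1\<close>, so the natural-number
  differences in the exponent are not truncated.
\<close>

definition christoffel ::
  "nat \<Rightarrow> nat \<Rightarrow> nat \<Rightarrow> (nat \<Rightarrow> complex) \<Rightarrow>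
   nat \<Rightarrow> nat \<Rightarrow> nat \<Rightarrow> (nat \<Rightarrow> complex) \<Rightarrow> nat \<Rightarrow> nat \<Rightarrow> complex" where
  "christoffel d ep em \<alpha> d' ep' em' \<alpha>' m l =
     (let \<xi> = node d ep em \<alpha> d' ep' em' \<alpha>' m l in
      (1 / 2) ^ ((1 - em) * (1 - em') * of_bool (l = 0)
                 + (1 - ep) * (1 - ep') * of_bool (m - l = 0))
      * inverse (of_real (2 * (real m - shift d ep em - shift d' ep' em'))
                 + (\<Sum>r\<in>{1..d}. u (\<alpha> r) \<xi>) + (\<Sum>r\<in>{1..d'}. u (\<alpha>' r) \<xi>)))"

definition cheb_weight :: "nat \<Rightarrow> nat \<Rightarrow> real \<Rightarrow> real" where
  "cheb_weight ep em \<xi> = 2 ^ (ep + em) * (1 + real ep * cos \<xi>) * (1 - real em * cos \<xi>)"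

end

theory Submission
  imports Defs "HOL-Complex_Analysis.Cauchy_Integral_Theorem"
begin

text \<open>
  With \<open>z = cis \<xi>\<close>, the exponential of \<open>\<i>\<close> times the left-hand side of the node
  equation is \<open>P z / Q z\<close>, where \<open>P\<close> is \<open>z\<close> to the power
  \<open>2 * (m - shift - shift')\<close> times the product of all \<open>z + \<alpha>\<close>, and \<open>Q\<close> is the product of all
  \<open>1 + \<alpha> * z\<close>. The node equation therefore says \<open>P = c * Q\<close> with \<open>c\<close> a sign, and monotonicity of
  the phase provides as many roots of \<open>W = P - c * Q\<close> on the unit circle as its degree allows:
  they are simple, and there are no others.

  Write \<open>g\<close> for the integrand. The degree condition says exactly that \<open>g P / z\<close> is a polynomial
  divided by \<open>A\<close>, the product of the \<open>1 + \<alpha>\<^sub>r * z\<close> over the first family, so that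
  \<open>g P / W\<close> splits into partial fractions at the roots of \<open>W\<close>, whose residues are the
  terms of the quadrature sum, and a remainder \<open>k z = z * C z / A z\<close>. Under \<open>z \<mapsto> 1 / z\<close> the
  function \<open>g\<close> is invariant while \<open>P / W\<close> becomes \<open>1 - P / W\<close>; adding the expansions at \<open>z\<close> and
  \<open>1 / z\<close> gives \<open>g = S + k z + k (1 / z)\<close> with \<open>S\<close> the sum over all roots. As \<open>C / A\<close> has
  a primitive on a neighbourhood of the closed disc, only \<open>S\<close> contributes to the integral. Folding
  \<open>S\<close> along conjugation produces the halved weights at the end points; roots at \<open>1\<close> or
  \<open>- 1\<close> that are not among the nodes are zeros of the Chebyshev weight.
\<close>

section \<open>Polynomials with simple roots\<close>

lemma prod_roots_dvd:
  fixes p :: "'a :: field poly"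
  assumes "finite Z" "\<And>w. w \<in> Z \<Longrightarrow> poly p w = 0"
  shows "(\<Prod>w\<in>Z. [:- w, 1:]) dvd p"
  using assms
proof (induction Z rule: finite_induct)
  case (insert a Z)
  then obtain q where q: "p = (\<Prod>w\<in>Z. [:- w, 1:]) * q" by (auto elim: dvdE)
  have "poly p a = 0" using insert by auto
  moreover have "poly (\<Prod>w\<in>Z. [:- w, 1:]) a \<noteq> 0"
    using insert by (auto simp: poly_prod)
  ultimately have "[:- a, 1:] dvd q" by (simp add: q poly_eq_0_iff_dvd)
  then have "[:- a, 1:] * (\<Prod>w\<in>Z. [:- w, 1:]) dvd q * (\<Prod>w\<in>Z. [:- w, 1:])"
    by (intro mult_dvd_mono) auto
  then have "[:- a, 1:] * (\<Prod>w\<in>Z. [:- w, 1:]) dvd p" by (simp only: q mult.commute[of q])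
  then show ?case unfolding prod.insert[OF insert.hyps(1,2)] .
qed auto

lemma degree_prod_roots: "degree (\<Prod>w\<in>Z. [:- w, 1 :: 'a :: field:]) = card Z"
  by (cases "finite Z") (simp_all add: degree_prod_eq_sum_degree)

text \<open>The cofactor of the product of linear factors has degree 0. Applied to \<open>W\<close>,
  this gives both the simplicity and the completeness of the known roots.\<close>

lemma poly_eq_smult_prod_roots:
  fixes p :: "'a :: field poly"
  assumes "p \<noteq> 0" "degree p \<le> card Z" "finite Z" "\<And>w. w \<in> Z \<Longrightarrow> poly p w = 0"
  obtains l where "l \<noteq> 0" "p = smult l (\<Prod>w\<in>Z. [:- w, 1:])"
proof -
  obtain q where q: "p = (\<Prod>w\<in>Z. [:- w, 1:]) * q"
    using prod_roots_dvd[OF assms(3,4)] by (auto elim: dvdE)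
  have "q \<noteq> 0" using assms(1) q by auto
  moreover have "(\<Prod>w\<in>Z. [:- w, 1:]) \<noteq> 0" using assms(3) by (simp add: prod_zero_iff)
  ultimately have "degree p = card Z + degree q"
    by (simp add: q degree_mult_eq degree_prod_roots)
  then have "degree q = 0" using assms(2) by simp
  then obtain l where "q = [:l:]" using degree_eq_zeroE by blast
  then show ?thesis using that[of l] q \<open>q \<noteq> 0\<close> by (simp add: mult.commute)
qed

lemma poly_pderiv_prod_roots:
  fixes Z :: "'a :: real_normed_field set"
  assumes "finite Z" "w \<in> Z"
  shows "poly (pderiv (\<Prod>v\<in>Z. [:- v, 1:])) w = (\<Prod>v\<in>Z - {w}. w - v)"
proof -
  have "(\<Prod>v\<in>Z. [:- v, 1:]) = [:- w, 1:] * (\<Prod>v\<in>Z - {w}. [:- v, 1:])"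
    using assms by (rule prod.remove)
  then show ?thesis
    by (simp add: pderiv_mult pderiv_pCons poly_prod del: mult_pCons_left mult_pCons_right)
qed

text \<open>The coefficients of \<open>1 / (z - w)\<close> are the residues of
  \<open>B / (A * W)\<close>. With them \<open>D\<close> vanishes at every root of \<open>W\<close>,
  so \<open>W\<close> divides \<open>D\<close>, and the quotient is \<open>C\<close>. Keeping
  \<open>A\<close> as a factor avoids an expansion at the zeros of \<open>A\<close>.\<close>

lemma partial_fractions_simple_roots:
  fixes A B :: "complex poly"
  assumes W: "W = smult l (\<Prod>w\<in>Z. [:- w, 1:])" and l: "l \<noteq> 0" and Z: "finite Z"
    and A: "\<And>w. w \<in> Z \<Longrightarrow> poly A w \<noteq> 0"
  obtains C where "\<And>z. z \<notin> Z \<Longrightarrow> poly B z / poly W z =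
      poly A z * (\<Sum>w\<in>Z. poly B w / (poly A w * poly (pderiv W) w) / (z - w)) + poly C z"
proof -
  define r where "r w = poly B w / (poly A w * poly (pderiv W) w)" for w
  define V where "V w = smult l (\<Prod>v\<in>Z - {w}. [:- v, 1:])" for w
  define D where "D = B - A * (\<Sum>w\<in>Z. smult (r w) (V w))"
  have V_eq: "poly W z = (z - w) * poly (V w) z" if "w \<in> Z" for w z
    using prod.remove[OF Z that, of "\<lambda>v. z - v"]
    by (simp add: W V_def poly_prod)
  have V0: "poly (V w) v = 0" if "w \<in> Z" "v \<in> Z" "v \<noteq> w" for v w
    using that Z by (auto simp: V_def poly_prod)
  have V1: "poly (V w) w = poly (pderiv W) w" if "w \<in> Z" for w
    using that Z by (simp add: V_def W pderiv_smult poly_pderiv_prod_roots poly_prod)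
  have W'0: "poly (pderiv W) w \<noteq> 0" if "w \<in> Z" for w
    using that Z l by (simp add: W pderiv_smult poly_pderiv_prod_roots)
  have "poly D v = 0" if v: "v \<in> Z" for v
  proof -
    have "r w * poly (V w) v = 0" if "w \<in> Z - {v}" for w
      using that V0[of w v] v by auto
    then have "(\<Sum>w\<in>Z - {v}. r w * poly (V w) v) = 0" by (intro sum.neutral) blast
    then have "(\<Sum>w\<in>Z. r w * poly (V w) v) = r v * poly (V v) v"
      by (simp add: sum.remove[OF Z v])
    then show ?thesis using v A W'0 by (simp add: D_def poly_sum V1 r_def)
  qed
  then have "W dvd D" using prod_roots_dvd[OF Z, of D] l by (simp add: W smult_dvd_iff)
  then obtain C where C: "D = W * C" by (auto elim: dvdE)
  have "poly B z / poly W z = poly A z * (\<Sum>w\<in>Z. r w / (z - w)) + poly C z" if z: "z \<notin> Z" for z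
  proof -
    have Wz: "poly W z \<noteq> 0" using z l Z by (simp add: W poly_prod)
    have *: "poly (V w) z = poly W z / (z - w)" if "w \<in> Z" for w
      using V_eq[OF that, of z] z that by auto
    have "(\<Sum>w\<in>Z. r w * poly (V w) z) = poly W z * (\<Sum>w\<in>Z. r w / (z - w))"
      by (simp add: sum_distrib_left * mult_ac)
    moreover have "poly B z - poly A z * (\<Sum>w\<in>Z. r w * poly (V w) z) = poly W z * poly C z"
      using arg_cong[OF C, of "\<lambda>p. poly p z"] by (simp add: D_def poly_sum)
    ultimately show ?thesis using Wz by (simp add: field_simps)
  qed
  then show ?thesis using that by (simp add: r_def)
qed

text \<open>On the unit circle \<open>(z + inverse z) / 2\<close> is the cosine of the angle; the
  factor \<open>z ^ K\<close> clears its negative powers.\<close>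

lemma exists_poly_joukowski:
  fixes q :: "complex poly"
  assumes "degree q \<le> K"
  obtains F where "\<And>z. z \<noteq> 0 \<Longrightarrow> poly F z = z ^ K * poly q ((z + inverse z) / 2)"
proof -
  define F where "F = (\<Sum>i\<le>degree q. smult (coeff q i) (monom 1 (K - i) * [:1/2, 0, 1/2:] ^ i))"
  have "poly F z = z ^ K * poly q ((z + inverse z) / 2)" if z: "z \<noteq> 0" for z
  proof -
    have "z ^ K * ((z + inverse z) / 2) ^ i = z ^ (K - i) * (1/2 + z * (z * (1/2))) ^ i"
      if "i \<le> degree q" for i
    proof -
      have "1/2 + z * (z * (1/2)) = z * ((z + inverse z) / 2)" using z by (simp add: field_simps)
      moreover have "z ^ K = z ^ (K - i) * z ^ i" using that assms by (simp flip: power_add)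
      ultimately show ?thesis by (simp only: power_mult_distrib mult.assoc)
    qed
    then show ?thesis
      by (simp add: F_def poly_sum poly_monom poly_altdef[of q] sum_distrib_left mult.left_commute)
  qed
  then show ?thesis using that by blast
qed

section \<open>The phase of a single parameter\<close>

text \<open>For \<open>cmod \<alpha> < 1\<close> this is the primitive of \<open>u \<alpha>\<close>
  that vanishes at 0. Both logarithms then have arguments in the right half-plane, where the
  principal branch is smooth.\<close>

definition phase :: "complex \<Rightarrow> real \<Rightarrow> complex" where
  "phase \<alpha> \<xi> = of_real \<xi> + \<i> * (Ln (1 + \<alpha> * cis \<xi>) - Ln (1 + \<alpha> * cis (- \<xi>)))"

lemma Re_one_plus_pos: "cmod w < 1 \<Longrightarrow> 0 < Re (1 + w)"
  using abs_Re_le_cmod[of w] by simp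

lemma one_plus_cis_nz:
  assumes "cmod \<alpha> < 1"
  shows "1 + \<alpha> * cis \<xi> \<noteq> 0"
proof -
  have "0 < Re (1 + \<alpha> * cis \<xi>)"
    by (rule Re_one_plus_pos) (use assms in \<open>simp add: norm_mult\<close>)
  then show ?thesis by (metis order_less_irrefl zero_complex.sel(1))
qed

lemma one_plus_cos_factor:
  "1 + 2 * \<alpha> * of_real (cos \<xi>) + \<alpha>\<^sup>2 = (1 + \<alpha> * cis \<xi>) * (1 + \<alpha> * cis (- \<xi>))"
proof -
  have "cis \<xi> + cis (- \<xi>) = 2 * of_real (cos \<xi>)" by (simp add: complex_eq_iff)
  moreover have "cis \<xi> * cis (- \<xi>) = 1" by (simp add: cis_mult)
  ultimately show ?thesis by algebra
qed

lemma u_eq: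
  assumes "cmod \<alpha> < 1"
  shows "u \<alpha> \<xi> = 1 / (1 + \<alpha> * cis \<xi>) + 1 / (1 + \<alpha> * cis (- \<xi>)) - 1"
proof -
  have "cis \<xi> * cis (- \<xi>) = 1" by (simp add: cis_mult)
  then have "1 - \<alpha>\<^sup>2 = (1 + \<alpha> * cis (- \<xi>)) + (1 + \<alpha> * cis \<xi>)
      - (1 + \<alpha> * cis \<xi>) * (1 + \<alpha> * cis (- \<xi>))" by algebra
  then show ?thesis
    using one_plus_cis_nz[OF assms, of \<xi>] one_plus_cis_nz[OF assms, of "- \<xi>"]
    unfolding u_def one_plus_cos_factor by (simp add: divide_simps)
qed

text \<open>Inversion maps the unit disc around 1 into the half-plane of real part above 1/2, so the
  two reciprocals in \<open>u_eq\<close> together outweigh the \<open>- 1\<close>.\<close>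

lemma Re_u_pos:
  assumes "cmod \<alpha> < 1"
  shows "0 < Re (u \<alpha> \<xi>)"
proof -
  have *: "1 / 2 < Re (1 / (1 + w))" if w: "cmod w < 1" for w
  proof -
    have nz: "0 < Re (1 + w)" using w by (rule Re_one_plus_pos)
    have "(Re w)\<^sup>2 + (Im w)\<^sup>2 < 1" using w by (simp add: cmod_def)
    then have "(Re (1 + w))\<^sup>2 + (Im (1 + w))\<^sup>2 < 2 * Re (1 + w)"
      by (simp add: power2_eq_square algebra_simps)
    moreover have "0 < (Re (1 + w))\<^sup>2 + (Im (1 + w))\<^sup>2" using nz by (simp add: add_pos_nonneg)
    ultimately show ?thesis by (simp add: Re_divide field_simps)
  qed
  show ?thesis
    using *[of "\<alpha> * cis \<xi>"] *[of "\<alpha> * cis (- \<xi>)"] assms by (simp add: u_eq norm_mult)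
qed

lemma u_minus [simp]: "u \<alpha> (- \<xi>) = u \<alpha> \<xi>"
  by (simp add: u_def)

lemma u_periodic [simp]: "u \<alpha> (\<xi> + 2 * pi) = u \<alpha> \<xi>"
  by (simp add: u_def)

lemma cnj_u: "cnj (u \<alpha> \<xi>) = u (cnj \<alpha>) \<xi>"
  by (simp add: u_def)

lemma continuous_on_u:
  assumes "cmod \<alpha> < 1"
  shows "continuous_on S (u \<alpha>)"
proof -
  have "1 + 2 * \<alpha> * of_real (cos x) + \<alpha>\<^sup>2 \<noteq> 0" for x
    unfolding one_plus_cos_factor using assms one_plus_cis_nz by simp
  then show ?thesis unfolding u_def[abs_def] by (intro continuous_intros) auto
qed

lemma cis_has_vector_derivative:
  "((\<lambda>x. cis (s * x)) has_vector_derivative of_real s * \<i> * cis (s * \<xi>)) (at \<xi>)"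
proof -
  have "((\<lambda>x. exp (\<i> * of_real s * of_real x)) has_vector_derivative
      of_real s * \<i> * exp (\<i> * of_real s * of_real \<xi>)) (at \<xi>)"
    by (rule has_vector_derivative_real_field) (auto intro!: derivative_eq_intros)
  then show ?thesis by (simp add: cis_conv_exp mult.assoc)
qed

lemma phase_has_vector_derivative:
  assumes "cmod \<alpha> < 1"
  shows "(phase \<alpha> has_vector_derivative u \<alpha> \<xi>) (at \<xi> within S)"
proof -
  \<comment> \<open>A general \<open>s\<close> covers both logarithms of \<open>phase\<close>, by
    \<open>s = 1\<close> and \<open>s = - 1\<close>.\<close>
  have Ln: "((\<lambda>x. Ln (1 + \<alpha> * cis (s * x))) has_vector_derivative
      (of_real s * \<i> * cis (s * \<xi>) * \<alpha>) * (1 / (1 + \<alpha> * cis (s * \<xi>)))) (at \<xi>)" for s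
  proof -
    have nonpos: "1 + \<alpha> * cis (s * \<xi>) \<notin> \<real>\<^sub>\<le>\<^sub>0"
      using Re_one_plus_pos[of "\<alpha> * cis (s * \<xi>)"] assms
      by (auto simp: norm_mult complex_nonpos_Reals_iff)
    have inner: "((\<lambda>x. 1 + \<alpha> * cis (s * x)) has_vector_derivative
        of_real s * \<i> * cis (s * \<xi>) * \<alpha>) (at \<xi>)"
      by (rule derivative_eq_intros cis_has_vector_derivative refl)+ simp
    from nonpos have Ln: "(Ln has_field_derivative 1 / (1 + \<alpha> * cis (s * \<xi>)))
        (at (1 + \<alpha> * cis (s * \<xi>)))"
      by (auto intro!: derivative_eq_intros simp: field_simps)
    show ?thesis using field_vector_diff_chain_at[OF inner Ln] by (simp only: o_def)
  qed
  have "cis x * \<alpha> * (1 / (1 + \<alpha> * cis x)) = 1 - 1 / (1 + \<alpha> * cis x)" for x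
    using one_plus_cis_nz[OF assms, of x] by (simp add: field_simps)
  moreover have "1 + \<i> * (\<i> * z * \<alpha> * a + \<i> * w * \<alpha> * b) = 1 - z * \<alpha> * a - w * \<alpha> * b" for a b z w
    by (simp add: algebra_simps)
  ultimately have "u \<alpha> \<xi> = 1 + \<i> * (\<i> * cis \<xi> * \<alpha> * (1 / (1 + \<alpha> * cis \<xi>))
      + \<i> * cis (- \<xi>) * \<alpha> * (1 / (1 + \<alpha> * cis (- \<xi>))))"
    by (simp only: u_eq[OF assms]) simp
  then have "(phase \<alpha> has_vector_derivative u \<alpha> \<xi>) (at \<xi>)"
    unfolding phase_def[abs_def] using Ln[of 1] Ln[of "-1"]
    by (auto intro!: derivative_eq_intros)
  then show ?thesis by (rule has_vector_derivative_at_within)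
qed

lemma phase_0 [simp]: "phase \<alpha> 0 = 0"
  by (simp add: phase_def)

lemma phase_minus: "phase \<alpha> (- \<xi>) = - phase \<alpha> \<xi>"
  by (simp add: phase_def algebra_simps)

text \<open>The logarithms see the angle only through \<open>cis\<close>, so only the linear term
  grows.\<close>

lemma phase_plus_period:
  "phase \<alpha> (\<xi> + 2 * pi * of_int k) = phase \<alpha> \<xi> + 2 * of_real pi * of_int k"
proof -
  have "cis (\<xi> + 2 * pi * of_int k) = cis \<xi>"
    by (simp flip: cis_mult add: cis_multiple_2pi)
  moreover have "cis (- (\<xi> + 2 * pi * of_int k)) = cis (- \<xi>)"
    using calculation by (metis cis_inverse)
  ultimately show ?thesis by (simp add: phase_def algebra_simps)
qed

lemma exp_phase:
  assumes "cmod \<alpha> < 1"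
  shows "exp (\<i> * phase \<alpha> \<xi>) * (1 + \<alpha> * cis \<xi>) = cis \<xi> + \<alpha>"
proof -
  have "\<i> * phase \<alpha> \<xi> = \<i> * of_real \<xi> - Ln (1 + \<alpha> * cis \<xi>) + Ln (1 + \<alpha> * cis (- \<xi>))"
    by (simp add: phase_def algebra_simps flip: mult.assoc)
  then have "exp (\<i> * phase \<alpha> \<xi>) = cis \<xi> / (1 + \<alpha> * cis \<xi>) * (1 + \<alpha> * cis (- \<xi>))"
    using one_plus_cis_nz[OF assms, of \<xi>] one_plus_cis_nz[OF assms, of "- \<xi>"]
    by (simp only: exp_add exp_diff exp_Ln cis_conv_exp) simp
  then have "exp (\<i> * phase \<alpha> \<xi>) * (1 + \<alpha> * cis \<xi>) = cis \<xi> * (1 + \<alpha> * cis (- \<xi>))"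
    using one_plus_cis_nz[OF assms, of \<xi>] by simp
  then show ?thesis by (simp add: algebra_simps cis_mult)
qed

lemma cnj_phase:
  assumes "cmod \<alpha> < 1"
  shows "cnj (phase \<alpha> \<xi>) = phase (cnj \<alpha>) \<xi>"
proof -
  have "cnj (Ln (1 + \<alpha> * cis x)) = Ln (1 + cnj \<alpha> * cis (- x))" for x
  proof -
    have "1 + \<alpha> * cis x \<notin> \<real>\<^sub>\<le>\<^sub>0"
      using Re_one_plus_pos[of "\<alpha> * cis x"] assms
      by (auto simp: norm_mult complex_nonpos_Reals_iff)
    then show ?thesis by (simp add: cnj_Ln cis_cnj)
  qed
  from this[of \<xi>] this[of "- \<xi>"] show ?thesis by (simp add: phase_def algebra_simps)
qed

lemma interval_integral_u:
  assumes "cmod \<alpha> < 1"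
  shows "(LBINT x=0..\<xi>. u \<alpha> x) = phase \<alpha> \<xi>"
  using interval_integral_FTC_finite[of 0 \<xi> "u \<alpha>" "phase \<alpha>"] assms
  by (simp add: continuous_on_u phase_has_vector_derivative zero_ereal_def)

section \<open>Families closed under conjugation\<close>

text \<open>A paired family and its conjugate have the same multiset of values. This is what makes
  the sums of \<open>phase\<close> and of \<open>u\<close> real.\<close>

lemma sum_conj_paired:
  fixes h :: "complex \<Rightarrow> complex"
  assumes "conj_paired d \<alpha>"
  shows "(\<Sum>r\<in>{1..d}. h (cnj (\<alpha> r))) = (\<Sum>r\<in>{1..d}. h (\<alpha> r))"
proof -
  have "image_mset (\<lambda>r. cnj (\<alpha> r)) (mset_set {1..d}) = image_mset \<alpha> (mset_set {1..d})"
  proof (rule multiset_eqI)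
    fix z
    have "{r \<in> {1..d}. cnj (\<alpha> r) = z} = {r \<in> {1..d}. \<alpha> r = cnj z}" by auto
    moreover have "count (image_mset g (mset_set {1..d})) z = card {r \<in> {1..d}. g r = z}"
      for g :: "nat \<Rightarrow> complex"
      by (simp add: count_image_mset vimage_def Int_def conj_commute)
    ultimately show "count (image_mset (\<lambda>r. cnj (\<alpha> r)) (mset_set {1..d})) z =
        count (image_mset \<alpha> (mset_set {1..d})) z"
      using assms by (simp add: conj_paired_def)
  qed
  then have "image_mset h (image_mset (\<lambda>r. cnj (\<alpha> r)) (mset_set {1..d})) =
      image_mset h (image_mset \<alpha> (mset_set {1..d}))" by (rule arg_cong)
  then have "sum_mset (image_mset (\<lambda>r. h (cnj (\<alpha> r))) (mset_set {1..d})) =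
      sum_mset (image_mset (\<lambda>r. h (\<alpha> r)) (mset_set {1..d}))"
    by (simp add: image_mset.compositionality o_def)
  then show ?thesis by (simp add: sum_unfold_sum_mset)
qed

lemma admissible_norm: "admissible d \<alpha> \<Longrightarrow> r \<in> {1..d} \<Longrightarrow> cmod (\<alpha> r) < 1"
  by (auto simp: admissible_def)

lemma sum_u_real:
  assumes "admissible d \<alpha>"
  shows "(\<Sum>r\<in>{1..d}. u (\<alpha> r) \<xi>) \<in> \<real>"
  using assms sum_conj_paired[of d \<alpha> "\<lambda>a. u a \<xi>"]
  by (simp add: Reals_cnj_iff cnj_u admissible_def)

lemma sum_phase_real:
  assumes "admissible d \<alpha>"
  shows "(\<Sum>r\<in>{1..d}. phase (\<alpha> r) \<xi>) \<in> \<real>"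
  using assms sum_conj_paired[of d \<alpha> "\<lambda>a. phase a \<xi>"]
  by (simp add: Reals_cnj_iff cnj_phase admissible_norm admissible_def)

section \<open>The node polynomial\<close>

lemma power_mult_prod: "a ^ d * (\<Prod>r\<in>{1..d}. f r) = (\<Prod>r\<in>{1..d}. a * f r :: 'a :: comm_monoid_mult)"
  by (simp add: prod.distrib)

lemma cis_eq_imp_int:
  assumes "cis x = cis y"
  obtains k :: int where "x = y + 2 * pi * of_int k"
proof -
  have "sin x = sin y \<and> cos x = cos y" using assms by (simp add: complex_eq_iff)
  then show ?thesis using that unfolding sin_cos_eq_iff by blast
qed

definition num :: "nat \<Rightarrow> (nat \<Rightarrow> complex) \<Rightarrow> complex poly" where
  "num d \<alpha> = (\<Prod>r\<in>{1..d}. [:\<alpha> r, 1:])"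

definition den :: "nat \<Rightarrow> (nat \<Rightarrow> complex) \<Rightarrow> complex poly" where
  "den d \<alpha> = (\<Prod>r\<in>{1..d}. [:1, \<alpha> r:])"

lemma poly_num: "poly (num d \<alpha>) z = (\<Prod>r\<in>{1..d}. z + \<alpha> r)"
  by (simp add: num_def poly_prod add.commute)

lemma poly_den: "poly (den d \<alpha>) z = (\<Prod>r\<in>{1..d}. 1 + \<alpha> r * z)"
  by (simp add: den_def poly_prod mult.commute)

lemma degree_num: "degree (num d \<alpha>) \<le> d"
  unfolding num_def by (rule order_trans[OF degree_prod_sum_le]) auto

lemma degree_den: "degree (den d \<alpha>) \<le> d"
proof -
  have "degree (den d \<alpha>) \<le> (\<Sum>r\<in>{1..d}. degree [:1, \<alpha> r:])"
    unfolding den_def using degree_prod_sum_le[of "{1..d}" "\<lambda>r. [:1, \<alpha> r:]"] by (simp only: o_def) simp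
  also have "\<dots> \<le> (\<Sum>r\<in>{1..d}. 1)" by (intro sum_mono) simp
  finally show ?thesis by simp
qed

text \<open>\<open>num\<close> and \<open>den\<close> are reversals of each other, factor by factor;
  this is why \<open>P\<close> and \<open>Q\<close> are exchanged under inversion of
  \<open>z\<close>.\<close>

lemma poly_num_inverse: "z \<noteq> 0 \<Longrightarrow> z ^ d * poly (num d \<alpha>) (inverse z) = poly (den d \<alpha>) z"
  unfolding poly_num poly_den power_mult_prod by (intro prod.cong) (simp_all add: distrib_left mult.commute)

lemma poly_den_inverse: "z \<noteq> 0 \<Longrightarrow> z ^ d * poly (den d \<alpha>) (inverse z) = poly (num d \<alpha>) z"
  unfolding poly_num poly_den power_mult_prod by (intro prod.cong) (simp_all add: distrib_left)

lemma poly_den_nz: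
  assumes "admissible d \<alpha>"
  shows "poly (den d \<alpha>) (cis \<xi>) \<noteq> 0"
  using one_plus_cis_nz[OF admissible_norm[OF assms]] by (auto simp: poly_den)

lemma prod_cos_eq:
  "(\<Prod>r\<in>{1..d}. 1 + 2 * \<alpha> r * of_real (cos \<xi>) + (\<alpha> r)\<^sup>2) =
     poly (den d \<alpha>) (cis \<xi>) * poly (den d \<alpha>) (cis (- \<xi>))"
  by (simp add: one_plus_cos_factor prod.distrib poly_den)

lemma exp_sum_phase:
  assumes "admissible d \<alpha>"
  shows "exp (\<i> * (\<Sum>r\<in>{1..d}. phase (\<alpha> r) \<xi>)) * poly (den d \<alpha>) (cis \<xi>) = poly (num d \<alpha>) (cis \<xi>)"
proof -
  have "exp (\<i> * (\<Sum>r\<in>{1..d}. phase (\<alpha> r) \<xi>)) * poly (den d \<alpha>) (cis \<xi>) =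
      (\<Prod>r\<in>{1..d}. exp (\<i> * phase (\<alpha> r) \<xi>) * (1 + \<alpha> r * cis \<xi>))"
    by (simp add: sum_distrib_left exp_sum prod.distrib poly_den)
  also have "\<dots> = (\<Prod>r\<in>{1..d}. cis \<xi> + \<alpha> r)"
    using exp_phase admissible_norm[OF assms] by (intro prod.cong) auto
  finally show ?thesis by (simp add: poly_num)
qed

text \<open>All zeros of the denominator lie outside an open disc of radius
  \<open>1 / a > 1\<close>. The disc is convex and contains the unit circle, so a holomorphic
  primitive exists there.\<close>

lemma poly_den_primitive:
  assumes "admissible d \<alpha>"
  obtains M where "\<And>\<xi>. (M has_field_derivative poly C (cis \<xi>) / poly (den d \<alpha>) (cis \<xi>)) (at (cis \<xi>))"
proof -
  \<comment> \<open>The entry \<open>1/2\<close> keeps the maximum defined and positive for an empty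
    family.\<close>
  define a where "a = Max (insert (1/2) ((\<lambda>r. cmod (\<alpha> r)) ` {1..d}))"
  have a: "0 < a" "a < 1" using admissible_norm[OF assms]
    by (auto simp: a_def Max_gr_iff)
  have le: "cmod (\<alpha> r) \<le> a" if "r \<in> {1..d}" for r
    unfolding a_def by (rule Max_ge) (use that in auto)
  have nz: "poly (den d \<alpha>) z \<noteq> 0" if z: "z \<in> ball 0 (1 / a)" for z
  proof -
    have "1 + \<alpha> r * z \<noteq> 0" if r: "r \<in> {1..d}" for r
    proof -
      have "cmod (\<alpha> r * z) \<le> a * cmod z" using le[OF r] by (simp add: norm_mult mult_right_mono)
      also have "\<dots> < 1" using z a by (simp add: field_simps)
      finally show ?thesis by (metis Re_one_plus_pos order_less_irrefl zero_complex.sel(1))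
    qed
    then show ?thesis by (simp add: poly_den)
  qed
  have "(\<lambda>z. poly C z / poly (den d \<alpha>) z) holomorphic_on ball 0 (1 / a)"
    using nz by (intro holomorphic_intros) auto
  then obtain M where M: "(M has_field_derivative poly C x / poly (den d \<alpha>) x) (at x within ball 0 (1 / a))"
    if "x \<in> ball 0 (1 / a)" for x
    using holomorphic_convex_primitive'[OF convex_ball open_ball] by blast
  have "cis \<xi> \<in> ball 0 (1 / a)" for \<xi> using a by simp
  then show ?thesis using that[of M] M by (metis at_within_open open_ball)
qed

section \<open>The quadrature nodes on the unit circle\<close>

text \<open>In the application \<open>N\<close> is twice \<open>m\<close> minus both shifts, an
  integer even if the shifts are not, and \<open>e\<close> is \<open>em + em'\<close>.\<close>

locale circle_nodes =
  fixes d d' N e :: nat and \<alpha> \<alpha>' :: "nat \<Rightarrow> complex"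
  assumes adm: "admissible d \<alpha>" "admissible d' \<alpha>'" and N_pos: "0 < N"
begin

definition n :: nat where "n = N + d + d'"

definition Psi :: "real \<Rightarrow> complex" where
  "Psi \<xi> = of_nat N * of_real \<xi> + (\<Sum>r\<in>{1..d}. phase (\<alpha> r) \<xi>) + (\<Sum>r\<in>{1..d'}. phase (\<alpha>' r) \<xi>)"

definition dPsi :: "real \<Rightarrow> complex" where
  "dPsi \<xi> = of_nat N + (\<Sum>r\<in>{1..d}. u (\<alpha> r) \<xi>) + (\<Sum>r\<in>{1..d'}. u (\<alpha>' r) \<xi>)"

definition Phi :: "real \<Rightarrow> real" where "Phi \<xi> = Re (Psi \<xi>)"

definition c :: complex where "c = (-1) ^ e"

definition P :: "complex poly" where "P = monom 1 N * num d \<alpha> * num d' \<alpha>'"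

definition Q :: "complex poly" where "Q = den d \<alpha> * den d' \<alpha>'"

definition W :: "complex poly" where "W = P - smult c Q"

definition Z :: "complex set" where "Z = {w. poly W w = 0}"

section \<open>The phase as an odd, increasing bijection of the real line\<close>

lemma Psi_eq: "Psi \<xi> = of_real (Phi \<xi>)"
proof -
  have "Psi \<xi> \<in> \<real>"
    unfolding Psi_def using sum_phase_real adm by (intro Reals_add Reals_mult) auto
  then show ?thesis by (simp add: Phi_def)
qed

lemma dPsi_real: "dPsi \<xi> \<in> \<real>"
  unfolding dPsi_def using sum_u_real adm by (intro Reals_add) auto

lemma Re_dPsi_pos: "0 < Re (dPsi \<xi>)"
proof -
  have "0 \<le> Re (u (\<alpha> r) \<xi>)" if "r \<in> {1..d}" for r
    using Re_u_pos[OF admissible_norm[OF adm(1) that]] by (rule less_imp_le)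
  moreover have "0 \<le> Re (u (\<alpha>' r) \<xi>)" if "r \<in> {1..d'}" for r
    using Re_u_pos[OF admissible_norm[OF adm(2) that]] by (rule less_imp_le)
  ultimately show ?thesis using N_pos
    by (auto simp: dPsi_def intro!: add_pos_nonneg sum_nonneg)
qed

lemma dPsi_minus [simp]: "dPsi (- \<xi>) = dPsi \<xi>"
  by (simp add: dPsi_def)

lemma dPsi_periodic [simp]: "dPsi (\<xi> + 2 * pi) = dPsi \<xi>"
  by (simp add: dPsi_def)

lemma Psi_has_vector_derivative: "(Psi has_vector_derivative dPsi \<xi>) (at \<xi>)"
proof -
  have "((\<lambda>\<xi>. of_nat N * complex_of_real \<xi>) has_vector_derivative of_nat N) (at \<xi>)"
    by (auto intro!: derivative_eq_intros)
  then show ?thesis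
    unfolding Psi_def[abs_def] dPsi_def
    by (intro has_vector_derivative_add has_vector_derivative_sum phase_has_vector_derivative)
       (auto intro: admissible_norm[OF adm(1)] admissible_norm[OF adm(2)])
qed

lemma Phi_has_derivative: "(Phi has_real_derivative Re (dPsi \<xi>)) (at \<xi>)"
  using bounded_linear.has_vector_derivative[OF bounded_linear_Re Psi_has_vector_derivative]
  by (simp add: Phi_def[abs_def] has_real_derivative_iff_has_vector_derivative)

lemma Phi_strict_mono: "x < y \<Longrightarrow> Phi x < Phi y"
  using DERIV_pos_imp_increasing[of x y Phi] Phi_has_derivative Re_dPsi_pos by blast

lemma Phi_eq_iff: "Phi x = Phi y \<longleftrightarrow> x = y"
  by (metis Phi_strict_mono less_irrefl linorder_neqE_linordered_idom)

lemma Phi_minus: "Phi (- \<xi>) = - Phi \<xi>"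
  by (simp add: Phi_def Psi_def phase_minus sum_negf)

lemma Phi_plus_period: "Phi (\<xi> + 2 * pi * of_int k) = Phi \<xi> + 2 * pi * of_int k * real n"
  unfolding Phi_def Psi_def phase_plus_period by (simp add: sum.distrib n_def algebra_simps)

lemma Phi_0: "Phi 0 = 0"
  using Phi_minus[of 0] by simp

text \<open>Each period raises \<open>Phi\<close> by \<open>2 * pi * n\<close> with \<open>n\<close>
  positive, so \<open>k\<close> periods reach beyond \<open>\<bar>y\<bar>\<close>; oddness gives the
  lower end for the intermediate value theorem.\<close>

lemma Phi_surj: "\<exists>\<xi>. Phi \<xi> = y"
proof -
  define k where "k = \<lceil>\<bar>y\<bar>\<rceil>"
  have k: "\<bar>y\<bar> \<le> of_int k" by (simp add: k_def)
  have "1 * 1 \<le> pi * (2 * real n)" using pi_gt3 N_pos by (intro mult_mono) (auto simp: n_def)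
  then have "of_int k * 1 \<le> of_int k * (pi * (2 * real n))"
    using k by (intro mult_left_mono) auto
  then have "\<bar>y\<bar> \<le> Phi (2 * pi * of_int k)"
    using k Phi_plus_period[of 0 k] by (simp add: Phi_0 mult_ac)
  moreover have "Phi (- (2 * pi * of_int k)) = - Phi (2 * pi * of_int k)" by (rule Phi_minus)
  ultimately have "Phi (- (2 * pi * of_int k)) \<le> y" "y \<le> Phi (2 * pi * of_int k)" by linarith+
  moreover have "continuous_on S Phi" for S
    using Phi_has_derivative by (meson DERIV_continuous continuous_at_imp_continuous_on)
  moreover have "- (2 * pi * of_int k) \<le> 2 * pi * of_int k" using k by simp
  ultimately show ?thesis using IVT'[of Phi "- (2 * pi * of_int k)" y "2 * pi * of_int k"] by blast
qed

text \<open>Indexed by all integers: the indices from 0 to \<open>n - 1\<close> give all roots on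
  the circle, and index \<open>- 1\<close> helps to locate the angle 0.\<close>

definition x :: "int \<Rightarrow> real" where
  "x j = (SOME \<xi>. Phi \<xi> = pi * (real e + 2 * of_int j))"

lemma Phi_x: "Phi (x j) = pi * (real e + 2 * of_int j)"
  unfolding x_def using someI_ex[OF Phi_surj] .

text \<open>Oddness and the growth per period show that both angles have the same phase, and
  \<open>Phi\<close> is injective.\<close>

lemma x_reflect: "x (int n - int e - j) = 2 * pi - x j"
proof -
  have "Phi (2 * pi - x j) = Phi (x (int n - int e - j))"
    using Phi_plus_period[of "- x j" 1] by (simp add: Phi_minus Phi_x algebra_simps)
  then show ?thesis by (simp add: Phi_eq_iff)
qed

lemma x_period: "x (j + int n) = x j + 2 * pi"
proof -
  have "Phi (x j + 2 * pi) = Phi (x (j + int n))"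
    using Phi_plus_period[of "x j" 1] by (simp add: Phi_x algebra_simps)
  then show ?thesis by (simp add: Phi_eq_iff)
qed

lemma inj_cis_x: "inj_on (\<lambda>j. cis (x j)) {0..<int n}"
proof (rule inj_onI)
  fix i j assume ij: "i \<in> {0..<int n}" "j \<in> {0..<int n}" and "cis (x i) = cis (x j)"
  then obtain k where "x i = x j + 2 * pi * of_int k" using cis_eq_imp_int by blast
  then have "Phi (x i) = Phi (x j) + 2 * pi * of_int k * real n"
    using Phi_plus_period by simp
  then have "pi * (real_of_int i) = pi * (real_of_int j + of_int k * real n)"
    by (simp add: Phi_x algebra_simps)
  then have "real_of_int i = of_int (j + k * int n)" by simp
  then have *: "i = j + k * int n" unfolding of_int_eq_iff .
  then have "i mod int n = j mod int n" by simp
  then show "i = j" using ij by simp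
qed

section \<open>The polynomial \<open>W\<close>: its roots, symmetry and derivative\<close>

lemma c_square: "c * c = 1"
  by (simp add: c_def flip: power_mult_distrib)

lemma c_nz: "c \<noteq> 0"
  by (simp add: c_def)

lemma Q_nz: "poly Q (cis \<xi>) \<noteq> 0"
  using poly_den_nz adm by (simp add: Q_def)

lemma cis_Phi: "cis (Phi \<xi>) * poly Q (cis \<xi>) = poly P (cis \<xi>)"
proof -
  have "cis (Phi \<xi>) = exp (\<i> * Psi \<xi>)" by (simp add: cis_conv_exp Psi_eq)
  also have "\<dots> = cis \<xi> ^ N * exp (\<i> * (\<Sum>r\<in>{1..d}. phase (\<alpha> r) \<xi>))
      * exp (\<i> * (\<Sum>r\<in>{1..d'}. phase (\<alpha>' r) \<xi>))"
    unfolding Complex.DeMoivre by (simp add: Psi_def distrib_left exp_add cis_conv_exp)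
  finally show ?thesis
    using exp_sum_phase[OF adm(1), of \<xi>, symmetric] exp_sum_phase[OF adm(2), of \<xi>, symmetric]
    by (simp add: P_def Q_def poly_monom)
qed

lemma W_cis: "poly W (cis \<xi>) = poly Q (cis \<xi>) * (cis (Phi \<xi>) - c)"
  by (simp add: W_def flip: cis_Phi) (simp add: algebra_simps)

lemma W_cis_x: "poly W (cis (x j)) = 0"
proof -
  have "cis (Phi (x j)) = cis (real e * pi) * cis (2 * pi * of_int j)"
    by (simp add: Phi_x cis_mult algebra_simps)
  also have "\<dots> = c" by (simp add: c_def flip: Complex.DeMoivre)
  finally show ?thesis by (simp add: W_cis)
qed

lemma W_0: "poly W 0 = - c"
  using N_pos by (simp add: W_def P_def Q_def poly_monom poly_den zero_power)

lemma degree_W: "degree W \<le> n"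
proof -
  have "degree P \<le> degree (monom (1::complex) N) + degree (num d \<alpha>) + degree (num d' \<alpha>')"
    unfolding P_def by (meson add_mono_thms_linordered_semiring(3) degree_mult_le order_trans)
  also have "\<dots> \<le> n"
    using degree_num[of d \<alpha>] degree_num[of d' \<alpha>'] degree_monom_le[of "1::complex" N]
    by (simp add: n_def)
  finally have "degree P \<le> n" .
  moreover have "degree (smult c Q) \<le> n"
    using degree_mult_le[of "den d \<alpha>" "den d' \<alpha>'"] degree_den[of d \<alpha>] degree_den[of d' \<alpha>']
      degree_smult_le[of c Q] by (simp add: n_def Q_def)
  ultimately show ?thesis unfolding W_def by (rule degree_diff_le)
qed

lemma card_cis_x: "card ((\<lambda>j. cis (x j)) ` {0..<int n}) = n"
  using card_image[OF inj_cis_x] by simp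

lemma W_nz: "W \<noteq> 0"
  using W_0 c_nz by auto

lemma W_factor:
  obtains l where "l \<noteq> 0" "W = smult l (\<Prod>w\<in>(\<lambda>j. cis (x j)) ` {0..<int n}. [:- w, 1:])"
proof (rule poly_eq_smult_prod_roots[OF W_nz])
  show "degree W \<le> card ((\<lambda>j. cis (x j)) ` {0..<int n})"
    using degree_W by (simp add: card_cis_x)
qed (auto simp: W_cis_x that)

lemma Z_eq: "Z = (\<lambda>j. cis (x j)) ` {0..<int n}"
proof -
  obtain l where "l \<noteq> 0" "W = smult l (\<Prod>w\<in>(\<lambda>j. cis (x j)) ` {0..<int n}. [:- w, 1:])"
    by (rule W_factor)
  then show ?thesis by (auto simp: Z_def poly_prod)
qed

lemma finite_Z: "finite Z"
  by (simp add: Z_eq)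

text \<open>Inversion exchanges \<open>P\<close> and \<open>Q\<close>, and \<open>c * c = 1\<close>
  turns \<open>Q - c * P\<close> into \<open>- c * W\<close>.\<close>

lemma W_inverse:
  assumes "z \<noteq> 0"
  shows "z ^ n * poly W (inverse z) = - c * poly W z"
proof -
  have "z ^ n * poly P (inverse z) =
      (z ^ N * inverse z ^ N) * (z ^ d * poly (num d \<alpha>) (inverse z)) * (z ^ d' * poly (num d' \<alpha>') (inverse z))"
    by (simp add: P_def n_def power_add poly_monom mult_ac)
  also have "z ^ N * inverse z ^ N = 1" using assms by (simp flip: power_mult_distrib)
  finally have P: "z ^ n * poly P (inverse z) = poly Q z"
    using assms by (simp add: poly_num_inverse Q_def)
  have "z ^ n * poly Q (inverse z) =
      z ^ N * (z ^ d * poly (den d \<alpha>) (inverse z)) * (z ^ d' * poly (den d' \<alpha>') (inverse z))"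
    by (simp add: Q_def n_def power_add mult_ac)
  then have Q: "z ^ n * poly Q (inverse z) = poly P z"
    using assms by (simp add: poly_den_inverse P_def poly_monom)
  have "z ^ n * poly W (inverse z) = poly Q z - c * poly P z"
    by (simp add: W_def right_diff_distrib P mult.left_commute Q)
  also have "\<dots> = - c * poly W z"
    using c_square by (simp add: W_def algebra_simps flip: mult.assoc)
  finally show ?thesis .
qed

lemma inverse_Z: "inverse w \<in> Z" if "w \<in> Z"
proof -
  have "w \<noteq> 0" using that W_0 c_nz by (auto simp: Z_def)
  then show ?thesis using that W_inverse[of w] by (simp add: Z_def)
qed

text \<open>Two derivatives of \<open>poly W (cis t)\<close> are compared: by the chain rule, and
  through \<open>W_cis\<close>, where at a root only the derivative of the factor
  \<open>cis (Phi t) - c\<close> survives. This links the residues to the weights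
  \<open>1 / dPsi\<close>.\<close>

lemma pderiv_W:
  assumes "cis \<xi> \<in> Z"
  shows "cis \<xi> * poly (pderiv W) (cis \<xi>) = poly P (cis \<xi>) * dPsi \<xi>"
proof -
  have cPhi: "cis (Phi \<xi>) = c" using assms Q_nz by (simp add: Z_def W_cis)
  have dcis: "(cis has_vector_derivative \<i> * cis y) (at y)" for y
    using cis_has_vector_derivative[of 1] by simp
  have dpoly: "((\<lambda>t. poly p (cis t)) has_vector_derivative \<i> * cis \<xi> * poly (pderiv p) (cis \<xi>)) (at \<xi>)" for p
    using field_vector_diff_chain_at[OF dcis poly_DERIV[of p "cis \<xi>"]] by (simp add: o_def)
  have "(Phi has_vector_derivative Re (dPsi \<xi>)) (at \<xi>)"
    using Phi_has_derivative by (simp add: has_real_derivative_iff_has_vector_derivative)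
  from vector_diff_chain_at[OF this dcis]
  have "((\<lambda>t. cis (Phi t)) has_vector_derivative dPsi \<xi> * (\<i> * cis (Phi \<xi>))) (at \<xi>)"
    using dPsi_real[of \<xi>] by (simp add: o_def scaleR_conv_of_real)
  from has_vector_derivative_mult[OF dpoly[of Q] has_vector_derivative_diff[OF this has_vector_derivative_const[of c]]]
  have "((\<lambda>t. poly W (cis t)) has_vector_derivative poly Q (cis \<xi>) * (dPsi \<xi> * (\<i> * c))) (at \<xi>)"
    by (simp add: W_cis cPhi)
  then have "\<i> * cis \<xi> * poly (pderiv W) (cis \<xi>) = poly Q (cis \<xi>) * (dPsi \<xi> * (\<i> * c))"
    using dpoly[of W] vector_derivative_unique_at by blast
  then have "\<i> * (cis \<xi> * poly (pderiv W) (cis \<xi>)) = \<i> * (c * poly Q (cis \<xi>) * dPsi \<xi>)"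
    by (simp only: mult_ac)
  then show ?thesis by (simp flip: cis_Phi add: cPhi)
qed

section \<open>Quadrature\<close>

text \<open>The quotient is \<open>E / (E - c)\<close> with \<open>E = cis (Phi \<xi>)\<close>.
  Passing to \<open>- \<xi>\<close> inverts \<open>E\<close>, and \<open>c * c = 1\<close> gives
  \<open>c / (c - E)\<close>.\<close>

lemma P_over_W:
  assumes "cis \<xi> \<notin> Z"
  shows "poly P (cis \<xi>) / poly W (cis \<xi>) + poly P (cis (- \<xi>)) / poly W (cis (- \<xi>)) = 1"
proof -
  define E where "E = cis (Phi \<xi>)"
  have *: "poly P (cis t) / poly W (cis t) = cis (Phi t) / (cis (Phi t) - c)" for t
    using Q_nz[of t] by (simp add: W_cis flip: cis_Phi)
  have E: "E \<noteq> 0" "E - c \<noteq> 0" using assms by (auto simp: E_def Z_def W_cis)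
  have "inverse E / (inverse E - c) = c / (c - E)"
  proof -
    have "inverse E / (inverse E - c) = (c * inverse E * E) / (c * (inverse E - c) * E)"
      using E c_nz by simp
    also have "c * (inverse E - c) * E = c * (inverse E * E) - c * c * E" by algebra
    finally show ?thesis using E c_square by simp
  qed
  then have "poly P (cis (- \<xi>)) / poly W (cis (- \<xi>)) = c / (c - E)"
    by (simp add: * Phi_minus E_def)
  moreover have "c / (c - E) = - c / (E - c)"
    by (metis divide_minus_right minus_diff_eq minus_divide_left)
  ultimately show ?thesis using E by (simp add: * flip: E_def diff_divide_distrib)
qed

text \<open>The sum runs over all roots on the circle, so no term is halved yet. In the degree
  bound, \<open>N + d\<close> powers of \<open>z\<close> come from \<open>P\<close> and the
  numerator \<open>num d \<alpha>\<close> in it; one is spent on the division by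
  \<open>z\<close>.\<close>

lemma quadrature:
  fixes q :: "complex poly"
  assumes deg: "degree q \<le> N + d - 1"
  defines "g \<equiv> \<lambda>\<xi>. poly q (of_real (cos \<xi>)) /
      (\<Prod>r\<in>{1..d}. 1 + 2 * \<alpha> r * of_real (cos \<xi>) + (\<alpha> r)\<^sup>2)"
  shows "(g has_integral of_real pi * (\<Sum>j\<in>{0..<int n}. g (x j) / dPsi (x j))) {0..pi}"
proof -
  obtain F where F: "\<And>z. z \<noteq> 0 \<Longrightarrow> poly F z = z ^ (N + d - 1) * poly q ((z + inverse z) / 2)"
    using exists_poly_joukowski[OF deg] by blast
  define A where "A = den d \<alpha>"
  define B where "B = F * num d' \<alpha>'"
  define r where "r w = poly B w / (poly A w * poly (pderiv W) w)" for w
  have A_nz: "poly A (cis \<xi>) \<noteq> 0" for \<xi>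
    using poly_den_nz[OF adm(1)] by (simp add: A_def)
  have g_minus: "g (- \<xi>) = g \<xi>" for \<xi> by (simp add: g_def)
  \<comment> \<open>\<open>P\<close> contains \<open>num d \<alpha>\<close>, which at
    \<open>cis \<xi>\<close> is a power of \<open>cis \<xi>\<close> times the denominator at
    \<open>cis (- \<xi>)\<close>; this cancels one of the two factors of the denominator of
    \<open>g\<close>.\<close>
  have gP: "cis \<xi> * (poly B (cis \<xi>) / poly A (cis \<xi>)) = g \<xi> * poly P (cis \<xi>)" for \<xi>
  proof -
    define qc where "qc = poly q (of_real (cos \<xi>))"
    have "(cis \<xi> + inverse (cis \<xi>)) / 2 = of_real (cos \<xi>)" by (simp add: complex_eq_iff)
    then have "poly F (cis \<xi>) = cis \<xi> ^ (N + d - 1) * qc" using F[of "cis \<xi>"] by (simp add: qc_def)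
    moreover have "cis \<xi> * cis \<xi> ^ (N + d - 1) = cis \<xi> ^ N * cis \<xi> ^ d"
      using N_pos by (simp flip: power_add power_Suc)
    ultimately have 1: "cis \<xi> * poly F (cis \<xi>) = cis \<xi> ^ N * cis \<xi> ^ d * qc"
      by (simp flip: mult.assoc)
    have 2: "poly (num d \<alpha>) (cis \<xi>) = cis \<xi> ^ d * poly A (cis (- \<xi>))"
      using poly_den_inverse[of "cis \<xi>" d \<alpha>] by (simp add: A_def)
    have "cis \<xi> * (poly B (cis \<xi>) / poly A (cis \<xi>)) =
        cis \<xi> * poly F (cis \<xi>) * poly (num d' \<alpha>') (cis \<xi>) / poly A (cis \<xi>)"
      by (simp add: B_def)
    also have "\<dots> = qc / (poly A (cis \<xi>) * poly A (cis (- \<xi>))) * poly P (cis \<xi>)"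
      using A_nz[of "- \<xi>"] A_nz[of \<xi>] unfolding 1
      by (simp add: P_def 2 poly_monom)
    finally show ?thesis unfolding g_def prod_cos_eq qc_def A_def .
  qed
  have r_cis: "r (cis \<xi>) = g \<xi> / dPsi \<xi>" if "cis \<xi> \<in> Z" for \<xi>
  proof -
    have "poly P (cis \<xi>) \<noteq> 0" using cis_Phi[of \<xi>] Q_nz[of \<xi>] by (metis cis_neq_zero mult_eq_0_iff)
    moreover have "r (cis \<xi>) = (cis \<xi> * (poly B (cis \<xi>) / poly A (cis \<xi>))) / (cis \<xi> * poly (pderiv W) (cis \<xi>))"
      by (simp add: r_def)
    ultimately show ?thesis unfolding gP pderiv_W[OF that] by simp
  qed
  \<comment> \<open>Inverting a root reverses its angle, and both \<open>g\<close> and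
    \<open>dPsi\<close> are even.\<close>
  have r_inverse: "r (inverse w) = r w" if w: "w \<in> Z" for w
  proof -
    obtain j where j: "w = cis (x j)" using w by (auto simp: Z_eq)
    show ?thesis using r_cis[of "x j"] r_cis[of "- x j"] w inverse_Z[OF w] by (simp add: j g_minus)
  qed
  define S where "S = (\<Sum>w\<in>Z. r w)"
  have "\<exists>C. \<forall>z. z \<notin> Z \<longrightarrow> poly B z / poly W z = poly A z * (\<Sum>w\<in>Z. r w / (z - w)) + poly C z"
  proof -
    obtain l where l: "l \<noteq> 0" "W = smult l (\<Prod>w\<in>Z. [:- w, 1:])"
      using W_factor unfolding Z_eq .
    have "poly A w \<noteq> 0" if "w \<in> Z" for w using that A_nz by (auto simp: Z_eq)
    from partial_fractions_simple_roots[OF l(2,1) finite_Z this, of B]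
    show ?thesis unfolding r_def by metis
  qed
  then obtain C where C: "\<And>z. z \<notin> Z \<Longrightarrow>
      poly B z / poly W z = poly A z * (\<Sum>w\<in>Z. r w / (z - w)) + poly C z" by blast
  define k where "k z = z * (poly C z / poly A z)" for z
  define h where "h z = (\<Sum>w\<in>Z. r w * (z / (z - w)))" for z
  have expand: "g \<xi> * (poly P (cis \<xi>) / poly W (cis \<xi>)) = h (cis \<xi>) + k (cis \<xi>)"
    if "cis \<xi> \<notin> Z" for \<xi>
  proof -
    have "g \<xi> * (poly P (cis \<xi>) / poly W (cis \<xi>)) = cis \<xi> * (poly B (cis \<xi>) / poly W (cis \<xi>)) / poly A (cis \<xi>)"
      using arg_cong[OF gP[of \<xi>, symmetric], of "\<lambda>y. y / poly W (cis \<xi>)"] by (simp add: mult_ac)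
    also have "\<dots> = cis \<xi> * (\<Sum>w\<in>Z. r w / (cis \<xi> - w)) + k (cis \<xi>)"
      unfolding C[OF that] using A_nz[of \<xi>] by (simp add: k_def field_simps)
    finally show ?thesis by (simp add: h_def sum_distrib_left mult_ac)
  qed
  \<comment> \<open>Replacing \<open>w\<close> by its inverse turns the kernel at
    \<open>inverse z\<close> into \<open>- w / (z - w)\<close>, which complements
    \<open>z / (z - w)\<close> to 1.\<close>
  have h_sum: "h z + h (inverse z) = S" if z: "z \<noteq> 0" "z \<notin> Z" for z
  proof -
    have "h (inverse z) = (\<Sum>w\<in>Z. r w * (inverse z / (inverse z - inverse w)))"
      unfolding h_def
      by (rule sum.reindex_bij_witness[of _ inverse inverse]) (auto simp: inverse_Z r_inverse)
    also have "\<dots> = (\<Sum>w\<in>Z. r w * (- w / (z - w)))"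
    proof (intro sum.cong refl)
      fix w assume w: "w \<in> Z"
      then have "w \<noteq> 0" "z - w \<noteq> 0" using z by (auto simp: Z_eq)
      then show "r w * (inverse z / (inverse z - inverse w)) = r w * (- w / (z - w))"
        using z by (simp add: divide_simps) (simp add: algebra_simps)
    qed
    finally have "h z + h (inverse z) = (\<Sum>w\<in>Z. r w * (z / (z - w)) + r w * (- w / (z - w)))"
      by (simp only: h_def[of z] sum.distrib)
    also have "\<dots> = S" unfolding S_def
    proof (intro sum.cong refl)
      fix w assume "w \<in> Z"
      then have "z - w \<noteq> 0" using z by auto
      then have "z / (z - w) + - w / (z - w) = 1" by (simp flip: add_divide_distrib diff_divide_distrib)
      then show "r w * (z / (z - w)) + r w * (- w / (z - w)) = r w"
        by (metis distrib_left mult.right_neutral)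
    qed
    finally show ?thesis .
  qed
  have g_eq: "g \<xi> = S + k (cis \<xi>) + k (cis (- \<xi>))" if \<xi>: "cis \<xi> \<notin> Z" for \<xi>
  proof -
    have "cis (- \<xi>) \<notin> Z" using inverse_Z[of "cis (- \<xi>)"] \<xi> by auto
    have "g \<xi> = g \<xi> * (poly P (cis \<xi>) / poly W (cis \<xi>) + poly P (cis (- \<xi>)) / poly W (cis (- \<xi>)))"
      using P_over_W[OF \<xi>] by simp
    also have "\<dots> = (h (cis \<xi>) + k (cis \<xi>)) + (h (cis (- \<xi>)) + k (cis (- \<xi>)))"
      using expand[OF \<xi>] expand[OF \<open>cis (- \<xi>) \<notin> Z\<close>] by (simp only: distrib_left g_minus)
    finally show ?thesis using h_sum[of "cis \<xi>"] \<xi> by simp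
  qed
  obtain M where M: "\<And>\<xi>. (M has_field_derivative poly C (cis \<xi>) / poly A (cis \<xi>)) (at (cis \<xi>))"
    using poly_den_primitive[OF adm(1)] unfolding A_def by blast
  \<comment> \<open>A primitive of the right-hand side of \<open>g_eq\<close>; the factors
    \<open>1\<close> and \<open>- 1\<close> match \<open>dM\<close>.\<close>
  define G where "G t = S * of_real t - \<i> * M (cis (1 * t)) + \<i> * M (cis (- 1 * t))" for t
  have dM: "((\<lambda>t. M (cis (s * t))) has_vector_derivative of_real s * \<i> * k (cis (s * t))) (at t)" for s t
    using field_vector_diff_chain_at[OF cis_has_vector_derivative M, of s t]
    by (simp add: o_def k_def mult_ac)
  have dG: "(G has_vector_derivative S + k (cis t) + k (cis (- t))) (at t)" for t
    unfolding G_def[abs_def] using dM[of 1 t] dM[of "- 1" t]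
    by (auto intro!: derivative_eq_intros)
  have "finite {t \<in> {0..pi}. cis t \<in> Z}"
  proof -
    have "inj_on cis {0..pi}"
      by (intro inj_onI) (metis atLeastAtMost_iff arccos_cos complex.sel(1) cis.ctr)
    then have "finite (cis -` Z \<inter> {0..pi})" by (rule finite_vimage_IntI[OF finite_Z])
    then show ?thesis by (simp add: vimage_def Int_def conj_commute)
  qed
  then have "(g has_integral G pi - G 0) {0..pi}"
  proof (rule fundamental_theorem_of_calculus_strong)
    show "(G has_vector_derivative g t) (at t)" if "t \<in> {0..pi} - {t \<in> {0..pi}. cis t \<in> Z}" for t
      using dG[of t] that by (simp add: g_eq)
    show "continuous_on {0..pi} G"
      using dG by (meson continuous_at_imp_continuous_on has_vector_derivative_continuous)
  qed simp
  \<comment> \<open>At both ends the two angles in \<open>G\<close> give the same point of the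
    circle, so the terms with \<open>M\<close> cancel.\<close>
  moreover have "cis (- pi) = cis pi" by (simp add: complex_eq_iff)
  then have "G pi - G 0 = of_real pi * S" by (simp add: G_def)
  moreover have "S = (\<Sum>j\<in>{0..<int n}. g (x j) / dPsi (x j))"
  proof -
    have "S = (\<Sum>j\<in>{0..<int n}. r (cis (x j)))"
      unfolding S_def Z_eq using inj_cis_x by (subst sum.reindex) (auto simp: o_def)
    also have "\<dots> = (\<Sum>j\<in>{0..<int n}. g (x j) / dPsi (x j))"
      by (intro sum.cong refl r_cis) (auto simp: Z_eq)
    finally show ?thesis .
  qed
  ultimately show ?thesis by simp
qed

end

text \<open>The reflection preserves the indices up to \<open>2 * m + p\<close>. The values 0, 1, 2
  of \<open>e\<close> mean that the sum stops one short of this range, matches it, or has one extra,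
  vanishing term. The value of \<open>p\<close> acts likewise at the middle, where the upper half is
  reflected onto the indices below \<open>m + p\<close>.\<close>

lemma sum_reflect_half:
  fixes T :: "nat \<Rightarrow> complex"
  assumes m: "0 < m" and ep: "e \<le> 2" "p \<le> 2"
    and reflect: "\<And>l. l \<le> 2 * m + p \<Longrightarrow> T (2 * m + p - l) = T l"
    and vanish: "p = 2 \<Longrightarrow> T (m + 1) = 0" "e = 2 \<Longrightarrow> T (2 * m + p + 1) = 0"
  shows "(\<Sum>l<2 * m + p + e. T l) =
    2 * (\<Sum>l\<le>m. (1 / 2) ^ (of_bool (e = 0 \<and> l = 0) + of_bool (p = 0 \<and> l = m)) * T l)"
proof -
  have "T (2 * m + p) = T 0" using reflect[of 0] by simp
  moreover have "e = 0 \<or> e = 1 \<or> e = 2" using ep by auto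
  ultimately have 1: "(\<Sum>l<2 * m + p + e. T l) = (\<Sum>l\<le>2 * m + p. T l) - of_bool (e = 0) * T 0"
    using vanish(2) by (auto simp: lessThan_Suc_atMost[symmetric])
  have "(\<Sum>l\<in>{m+1..2*m+p}. T l) = (\<Sum>l<m + p. T l)"
    by (rule sum.reindex_bij_witness[of _ "\<lambda>l. 2 * m + p - l" "\<lambda>l. 2 * m + p - l"])
       (auto simp: reflect)
  moreover have "{..2 * m + p} = {..m} \<union> {m+1..2*m+p}" by auto
  ultimately have 2: "(\<Sum>l\<le>2 * m + p. T l) = (\<Sum>l\<le>m. T l) + (\<Sum>l<m + p. T l)"
    by (simp add: sum.union_disjoint del: One_nat_def)
  have "p = 0 \<or> p = 1 \<or> p = 2" using ep by auto
  then have 3: "(\<Sum>l<m + p. T l) = (\<Sum>l\<le>m. T l) - of_bool (p = 0) * T m"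
    using vanish(1) by (auto simp: lessThan_Suc_atMost[symmetric])
  have "(\<Sum>l\<le>m. (1 / 2) ^ (of_bool (e = 0 \<and> l = 0) + of_bool (p = 0 \<and> l = m)) * T l) =
      (\<Sum>l\<le>m. T l - (if l = 0 then of_bool (e = 0) * T 0 / 2 else 0)
        - (if l = m then of_bool (p = 0) * T m / 2 else 0))"
    using m by (intro sum.cong) auto
  also have "\<dots> = (\<Sum>l\<le>m. T l) - of_bool (e = 0) * T 0 / 2 - of_bool (p = 0) * T m / 2"
    by (simp add: sum_subtractf)
  finally show ?thesis unfolding 1 2 3 by simp
qed

section \<open>From the sum over the circle to the Christoffel weights\<close>

theorem theorem5:
  fixes d d' ep em ep' em' m :: nat
    and \<alpha> \<alpha>' :: "nat \<Rightarrow> complex"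
    and f :: "complex poly"
    and R :: "real \<Rightarrow> complex"
  assumes signs: "ep \<in> {0, 1}" "em \<in> {0, 1}" "ep' \<in> {0, 1}" "em' \<in> {0, 1}"
    and params: "admissible d \<alpha>" "admissible d' \<alpha>'"
    and m: "0 < m" "int m > \<lceil>shift d ep em\<rceil> + \<lceil>shift d' ep' em'\<rceil>"
    and deg: "f = 0 \<or> real (degree f) \<le> 2 * (real m - shift d' ep' em') - 1"
    and R: "\<And>\<xi>. R \<xi> = poly f (of_real (cos \<xi>)) /
                      (\<Prod>r\<in>{1..d}. 1 + 2 * \<alpha> r * of_real (cos \<xi>) + (\<alpha> r)\<^sup>2)"
  shows "(\<forall>l\<in>{0..m}. christoffel d ep em \<alpha> d' ep' em' \<alpha>' m l \<in> \<real> \<and>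
                     0 < Re (christoffel d ep em \<alpha> d' ep' em' \<alpha>' m l)) \<and>
         1 / (2 * of_real pi) * (LBINT \<xi>=0..pi. R \<xi> * of_real (cheb_weight ep em \<xi>)) =
         (\<Sum>l\<in>{0..m}. R (node d ep em \<alpha> d' ep' em' \<alpha>' m l)
                      * of_real (cheb_weight ep em (node d ep em \<alpha> d' ep' em' \<alpha>' m l))
                      * christoffel d ep em \<alpha> d' ep' em' \<alpha>' m l)"
proof -
  define e where "e = em + em'"
  define p where "p = ep + ep'"
  define N where "N = 2 * m + p + e - d - d'"
  have sg: "ep = 0 \<or> ep = 1" "em = 0 \<or> em = 1" "ep' = 0 \<or> ep' = 1" "em' = 0 \<or> em' = 1"
    using signs by auto
  \<comment> \<open>Removing the ceilings gives \<open>d + d' < 2 * m + p + e\<close>, so the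
    subtraction in \<open>N\<close> is not truncated.\<close>
  have "shift d ep em + shift d' ep' em' \<le> of_int \<lceil>shift d ep em\<rceil> + of_int \<lceil>shift d' ep' em'\<rceil>"
    by (intro add_mono le_of_int_ceiling)
  also have "\<dots> < real m" using m(2) by (metis of_int_add of_int_less_iff of_int_of_nat_eq)
  finally have "real (d + d') < real (2 * m + p + e)"
    by (simp add: shift_def p_def e_def field_simps)
  then have "d + d' < 2 * m + p + e" by (simp only: of_nat_less_iff)
  then have N: "0 < N" "N + d + d' = 2 * m + p + e" by (auto simp: N_def)
  have real_N: "2 * (real m - shift d ep em - shift d' ep' em') = real N"
    using arg_cong[OF N(2), of real] by (simp add: shift_def p_def e_def field_simps)
  interpret circle_nodes d d' N e \<alpha> \<alpha>'
    by unfold_locales (use params N in auto)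
  have node_fun: "node_fun d ep em \<alpha> d' ep' em' \<alpha>' m \<xi> = Psi \<xi>" for \<xi>
  proof -
    have "(\<Sum>r\<in>{1..d}. LBINT x=0..\<xi>. u (\<alpha> r) x) = (\<Sum>r\<in>{1..d}. phase (\<alpha> r) \<xi>)"
      using admissible_norm[OF params(1)] by (intro sum.cong interval_integral_u) auto
    moreover have "(\<Sum>r\<in>{1..d'}. LBINT x=0..\<xi>. u (\<alpha>' r) x) = (\<Sum>r\<in>{1..d'}. phase (\<alpha>' r) \<xi>)"
      using admissible_norm[OF params(2)] by (intro sum.cong interval_integral_u) auto
    ultimately show ?thesis unfolding node_fun_def Psi_def real_N by simp
  qed
  have node: "node d ep em \<alpha> d' ep' em' \<alpha>' m l = x (int l)" for l
  proof -
    \<comment> \<open>Injectivity of \<open>Phi\<close> makes the solution unique, which evaluates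
      the definite description.\<close>
    have "(Psi \<xi> = of_real (pi * (2 * real l + real em + real em'))) = (\<xi> = x (int l))" for \<xi>
    proof -
      have "pi * (2 * real l + real em + real em') = Phi (x (int l))"
        unfolding Phi_x by (simp add: e_def add_ac)
      then show ?thesis by (simp only: Psi_eq of_real_eq_iff Phi_eq_iff)
    qed
    then show ?thesis unfolding node_def node_fun by simp
  qed
  have weight: "christoffel d ep em \<alpha> d' ep' em' \<alpha>' m l =
      (1 / 2) ^ (of_bool (e = 0 \<and> l = 0) + of_bool (p = 0 \<and> l = m)) * inverse (dPsi (x (int l)))"
    if "l \<le> m" for l
  proof -
    have "(1 - em) * (1 - em') * of_bool (l = 0) + (1 - ep) * (1 - ep') * of_bool (m - l = 0) =
        of_bool (e = 0 \<and> l = 0) + (of_bool (p = 0 \<and> l = m) :: nat)"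
      using sg that by (auto simp: e_def p_def)
    then show ?thesis unfolding christoffel_def Let_def node real_N dPsi_def by simp
  qed
  have pos: "christoffel d ep em \<alpha> d' ep' em' \<alpha>' m l \<in> \<real> \<and>
      0 < Re (christoffel d ep em \<alpha> d' ep' em' \<alpha>' m l)" if "l \<in> {0..m}" for l
  proof -
    obtain y where y: "dPsi (x (int l)) = of_real y"
      using dPsi_real Reals_cases by blast
    then have "0 < y" using Re_dPsi_pos[of "x (int l)"] by simp
    define k :: nat where "k = of_bool (e = 0 \<and> l = 0) + of_bool (p = 0 \<and> l = m)"
    have "christoffel d ep em \<alpha> d' ep' em' \<alpha>' m l = of_real ((1 / 2) ^ k * inverse y)"
      using that by (simp add: weight y k_def)
    then show ?thesis using \<open>0 < y\<close> by simp
  qed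
  define g where "g \<xi> = R \<xi> * of_real (cheb_weight ep em \<xi>)" for \<xi>
  define T where "T l = g (x (int l)) / dPsi (x (int l))" for l
  \<comment> \<open>The Chebyshev weight is absorbed into the numerator, raising the degree by at
    most \<open>ep + em\<close>.\<close>
  define q where "q = f * ([:2 ^ (ep + em):] * [:1, of_nat ep:] * [:1, - of_nat em:])"
  have g: "g = (\<lambda>\<xi>. poly q (of_real (cos \<xi>)) /
      (\<Prod>r\<in>{1..d}. 1 + 2 * \<alpha> r * of_real (cos \<xi>) + (\<alpha> r)\<^sup>2))"
  proof
    fix \<xi>
    have "poly q z = poly f z * (2 ^ (ep + em) * (1 + of_nat ep * z) * (1 - of_nat em * z))" for z
      unfolding q_def poly_mult by (simp add: mult.commute[of z])
    then show "g \<xi> = poly q (of_real (cos \<xi>)) /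
        (\<Prod>r\<in>{1..d}. 1 + 2 * \<alpha> r * of_real (cos \<xi>) + (\<alpha> r)\<^sup>2)"
      by (simp add: g_def R cheb_weight_def)
  qed
  have "(g has_integral of_real pi * (\<Sum>j\<in>{0..<int n}. g (x j) / dPsi (x j))) {0..pi}"
  \<comment> \<open>The degree bound can be \<open>- 1\<close>, in which case \<open>f\<close> has
    to be 0.\<close>
  proof (cases "f = 0")
    case True
    then show ?thesis by (simp add: g q_def)
  next
    case False
    have "degree ([:2 ^ (ep + em):] * [:1, of_nat ep:] * [:1, - of_nat em:] :: complex poly) \<le> ep + em"
      using sg by (auto simp: degree_pCons_eq_if)
    then have "degree q \<le> degree f + (ep + em)"
      unfolding q_def by (meson add_left_mono degree_mult_le order_trans)
    moreover have "degree f + (ep + em) + 1 \<le> N + d"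
    proof -
      have "real (degree f) \<le> 2 * (real m - shift d' ep' em') - 1" using deg False by simp
      then have "real (degree f + (ep + em) + 1 + d') \<le> real (N + d + d')"
        unfolding N(2) by (simp add: shift_def p_def e_def field_simps)
      then show ?thesis by simp
    qed
    ultimately show ?thesis unfolding g by (intro quadrature) linarith
  qed
  also have "(\<Sum>j\<in>{0..<int n}. g (x j) / dPsi (x j)) = (\<Sum>l<n. T l)"
    by (rule sum.reindex_bij_witness[of _ int nat]) (auto simp: T_def)
  also have "n = 2 * m + p + e" using N by (simp add: n_def)
  also have "(\<Sum>l<2 * m + p + e. T l) =
      2 * (\<Sum>l\<le>m. (1 / 2) ^ (of_bool (e = 0 \<and> l = 0) + of_bool (p = 0 \<and> l = m)) * T l)"
  proof (rule sum_reflect_half)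
    show "e \<le> 2" "p \<le> 2" using sg by (auto simp: e_def p_def)
    have n: "int n = 2 * int m + int p + int e" using N by (simp add: n_def)
    have g_reflect: "g (2 * pi - \<xi>) = g \<xi>" for \<xi> by (simp add: g cos_diff)
    have dPsi_reflect: "dPsi (2 * pi - \<xi>) = dPsi \<xi>" for \<xi>
      using dPsi_periodic[of "- \<xi>"] by simp
    show "T (2 * m + p - l) = T l" if "l \<le> 2 * m + p" for l
    proof -
      have "x (int (2 * m + p - l)) = 2 * pi - x (int l)"
        using x_reflect[of "int l"] that by (simp add: n of_nat_diff algebra_simps)
      then show ?thesis by (simp only: T_def g_reflect dPsi_reflect)
    qed
    show "T (m + 1) = 0" if "p = 2"
    proof -
      \<comment> \<open>Index \<open>m + 1\<close> is fixed by the reflection; at angle \<pi> the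
        weight factor with \<open>ep\<close> is 0.\<close>
      have "x (int (m + 1)) = pi" using x_reflect[of "int m + 1"] that by (simp add: n add_ac)
      moreover have "ep = 1" using that sg by (auto simp: p_def)
      ultimately show ?thesis by (simp add: T_def g_def cheb_weight_def)
    qed
    show "T (2 * m + p + 1) = 0" if "e = 2"
    proof -
      \<comment> \<open>For index \<open>- 1\<close> this is both the reflected and the
        period-shifted index, which forces \<open>x (- 1) = 0\<close>.\<close>
      have "x (int (2 * m + p + 1)) = 2 * pi"
        using x_reflect[of "- 1"] x_period[of "- 1"] that by (simp add: n add_ac)
      moreover have "em = 1" using that sg by (auto simp: e_def)
      ultimately show ?thesis by (simp add: T_def g_def cheb_weight_def)
    qed
  qed (rule m(1))
  finally have int: "(g has_integral of_real pi *
      (2 * (\<Sum>l\<le>m. (1 / 2) ^ (of_bool (e = 0 \<and> l = 0) + of_bool (p = 0 \<and> l = m)) * T l))) {0..pi}" .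
  \<comment> \<open>Continuity identifies the Lebesgue integral of the statement with the gauge
    integral computed above.\<close>
  have "continuous_on {0..pi} g"
    unfolding g prod_cos_eq using poly_den_nz[OF params(1)]
    by (intro continuous_on_divide continuous_on_mult continuous_on_poly continuous_intros) auto
  then have "set_integrable lborel {0..pi} g" by (rule borel_integrable_atLeastAtMost')
  then have "(LBINT \<xi>=0..pi. g \<xi>) = integral {0..pi} g"
    using interval_integral_eq_integral[of 0 pi g] by (simp add: zero_ereal_def)
  then have "1 / (2 * of_real pi) * (LBINT \<xi>=0..pi. g \<xi>) =
      (\<Sum>l\<le>m. (1 / 2) ^ (of_bool (e = 0 \<and> l = 0) + of_bool (p = 0 \<and> l = m)) * T l)"
    using integral_unique[OF int] by simp
  also have "\<dots> = (\<Sum>l\<in>{0..m}. g (x (int l)) * christoffel d ep em \<alpha> d' ep' em' \<alpha>' m l)"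
  proof (rule sum.cong)
    fix l assume "l \<in> {0..m}"
    then have "l \<le> m" by simp
    show "(1 / 2) ^ (of_bool (e = 0 \<and> l = 0) + of_bool (p = 0 \<and> l = m)) * T l =
        g (x (int l)) * christoffel d ep em \<alpha> d' ep' em' \<alpha>' m l"
      unfolding weight[OF \<open>l \<le> m\<close>] T_def divide_inverse by (simp only: mult_ac)
  qed (simp add: atMost_atLeast0)
  finally have "1 / (2 * of_real pi) * (LBINT \<xi>=0..pi. g \<xi>) =
      (\<Sum>l\<in>{0..m}. g (x (int l)) * christoffel d ep em \<alpha> d' ep' em' \<alpha>' m l)" .
  then show ?thesis using pos unfolding g_def node by blast
qed

end
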